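(* Let $q\ge2$ and let $\{n_j\}_{j=0}^\infty$ be a sequence of natural numbers such that $n_0=1$ and $$\frac{n_{j+1}}{n_j}\ge q\quad\text{for all }j\in\mathbb{Z}^+ .$$ Let $\{\delta_j\}_{j\in\mathbb{Z}^+}\in\ell^2(\mathbb{Z}^+)$ be a sequence of complex numbers. Define $G=\{G_n\}_{n\in\mathbb{Z}}$ by $G_{n_j}=\delta_j$ for all $j\in\mathbb{Z}^+$ and $G_n=0$ for all other $n\in\mathbb{Z}$. Then the $SU(2)$ nonlinear Fourier transforms $$\begin{pmatrix}\mathfrak{a}(z,G^{\langle N\rangle})\\ \mathfrak{b}(z,G^{\langle N\rangle})\end{pmatrix}$$ of the truncations $G^{\langle N\rangle}$ converge, as $N\to\infty$, for (Lebesgue) a.e. $z\in\mathbb{T}$.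
   Context: $\mathbb{N}=\{1,2,\ldots\}$, $\mathbb{Z}^+=\{0,1,2,\ldots\}$, $\mathbb{T}$ is the unit circle in $\mathbb{C}$. For a sequence $G=\{G_n\}_{n\in\mathbb{Z}}$ of complex numbers and $N\in\mathbb{Z}^+$, the truncation is $G^{\langle N\rangle}_n=G_n$ if $|n|\le N$ and $G^{\langle N\rangle}_n=0$ otherwise. Define $2\times2$ matrices $Z_n(z,G^{\langle N\rangle})$, $n\in\mathbb{Z}$, by $Z_n=I$ for $n<-N$ and $$Z_n=\frac{1}{(1+|G_n^{\langle N\rangle}|^2)^{1/2}}\begin{pmatrix}1&-\overline{G_n^{\langle N\rangle}}z^{-n}\\ G_n^{\langle N\rangle}z^n&1\end{pmatrix}Z_{n-1}.$$ These matrices have the form $$Z_n(z,G^{\langle N\rangle})=\begin{pmatrix}\mathfrak{a}_n(z,G^{\langle N\rangle})&-\mathfrak{b}_n^{( * )}(z,G^{\langle N\rangle})\\ \mathfrak{b}_n(z,G^{\langle N\rangle})&\mathfrak{a}_n^{( * )}(z,G^{\langle N\rangle})\end{pmatrix},\qquad f^{( * )}(z):=\overline{f(\bar z^{-1})},$$ so $f^{( * )}(z)=\overline{f(z)}$ for $z\in\mathbb{T}$. Since $Z_n$ does not depend on $n$ for $n\ge N$, one sets $\mathfrak{a}(z,G^{\langle N\rangle}):=\mathfrak{a}_n(z,G^{\langle N\rangle})$ and $\mathfrak{b}(z,G^{\langle N\rangle}):=\mathfrak{b}_n(z,G^{\langle N\rangle})$ for any $n\ge N$. The $SU(2)$ nonlinear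 Fourier transform of $G^{\langle N\rangle}$ is the column vector $\begin{pmatrix}\mathfrak{a}(z,G^{\langle N\rangle})\\ \mathfrak{b}(z,G^{\langle N\rangle})\end{pmatrix}$. *)

theory Defs
  imports "HOL-Analysis.Analysis"
begin

definition trunc :: "(int \<Rightarrow> complex) \<Rightarrow> nat \<Rightarrow> int \<Rightarrow> complex" where
  "trunc G N n = (if \<bar>n\<bar> \<le> int N then G n else 0)"

definition nlft_factor :: "complex \<Rightarrow> int \<Rightarrow> complex \<Rightarrow> complex ^ 2 ^ 2" where
  "nlft_factor g n z =
     (1 / sqrt (1 + (cmod g)\<^sup>2)) *\<^sub>R
       vector [vector [1, - cnj g * z powi (- n)],
               vector [g * z powi n, 1]]"

function nlft_matrix :: "(int \<Rightarrow> complex) \<Rightarrow> nat \<Rightarrow> int \<Rightarrow> complex \<Rightarrow> complex ^ 2 ^ 2" where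
  "nlft_matrix G N n z =
     (if n < - int N then mat 1
      else nlft_factor (trunc G N n) n z ** nlft_matrix G N (n - 1) z)"
  by pat_completeness auto
termination
  by (relation "Wellfounded.measure (\<lambda>(G, N, n, z). nat (n + int N + 1))") auto

declare nlft_matrix.simps [simp del]

definition nlft_a_partial :: "(int \<Rightarrow> complex) \<Rightarrow> nat \<Rightarrow> int \<Rightarrow> complex \<Rightarrow> complex" where
  "nlft_a_partial G N n z = nlft_matrix G N n z $ 1 $ 1"

definition nlft_b_partial :: "(int \<Rightarrow> complex) \<Rightarrow> nat \<Rightarrow> int \<Rightarrow> complex \<Rightarrow> complex" where
  "nlft_b_partial G N n z = nlft_matrix G N n z $ 2 $ 1"

definition para_conj :: "(complex \<Rightarrow> complex) \<Rightarrow> complex \<Rightarrow> complex" where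
  "para_conj f z = cnj (f (inverse (cnj z)))"

lemma nlft_matrix_form:
  assumes "z \<noteq> 0"
  shows "nlft_matrix G N n z =
    vector [vector [nlft_a_partial G N n z, - para_conj (nlft_b_partial G N n) z],
            vector [nlft_b_partial G N n z, para_conj (nlft_a_partial G N n) z]]"
  using assms
proof (induction G N n z rule: nlft_matrix.induct)
  case (1 G N n z)
  let ?w = "inverse (cnj z)"
  show ?case
  proof (cases "n < - int N")
    case True
    then show ?thesis
      by (simp add: vec_eq_iff forall_2 nlft_a_partial_def nlft_b_partial_def para_conj_def
          nlft_matrix.simps mat_def)
  next
    case False
    have step: "nlft_matrix G N n u =
        nlft_factor (trunc G N n) n u ** nlft_matrix G N (n - 1) u" for u
      using False by (subst nlft_matrix.simps) simp
    have IH: "nlft_matrix G N (n - 1) z $ 1 $ 2 = - cnj (nlft_matrix G N (n - 1) ?w $ 2 $ 1)"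
      "nlft_matrix G N (n - 1) z $ 2 $ 2 = cnj (nlft_matrix G N (n - 1) ?w $ 1 $ 1)"
      using "1.IH"[OF False "1.prems"]
      by (auto simp: vec_eq_iff forall_2 nlft_a_partial_def nlft_b_partial_def para_conj_def)
    show ?thesis
      using "1.prems"
      by (simp add: vec_eq_iff forall_2 nlft_a_partial_def nlft_b_partial_def para_conj_def
          step matrix_matrix_mult_def sum_2 nlft_factor_def IH power_int_minus
          power_int_inverse algebra_simps)
  qed
qed

lemma nlft_matrix_stable:
  assumes "int N \<le> n"
  shows "nlft_matrix G N n z = nlft_matrix G N (int N) z"
  using assms
proof (induction n rule: int_ge_induct)
  case (step i)
  have "nlft_factor 0 (i + 1) z = mat 1"
    by (simp add: vec_eq_iff forall_2 nlft_factor_def mat_def)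
  moreover have "trunc G N (i + 1) = 0"
    using step by (simp add: trunc_def)
  ultimately have "nlft_matrix G N (i + 1) z = nlft_matrix G N i z"
    using step by (subst nlft_matrix.simps) simp
  with step show ?case by simp
qed simp

text \<open>
  The transform of the truncation of \<open>G\<close> to \<open>{-N..N}\<close>. The index \<open>n = N\<close> stands for any
  \<open>n \<ge> N\<close>, by the preceding lemma.
\<close>

definition nlft_a :: "(int \<Rightarrow> complex) \<Rightarrow> nat \<Rightarrow> complex \<Rightarrow> complex" where
  "nlft_a G N z = nlft_a_partial G N (int N) z"

definition nlft_b :: "(int \<Rightarrow> complex) \<Rightarrow> nat \<Rightarrow> complex \<Rightarrow> complex" where
  "nlft_b G N z = nlft_b_partial G N (int N) z"

definition nlft :: "(int \<Rightarrow> complex) \<Rightarrow> nat \<Rightarrow> complex \<Rightarrow> complex ^ 2" where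
  "nlft G N z = vector [nlft_a G N z, nlft_b G N z]"

text \<open>
  Lebesgue (arc length) measure on the unit circle, on its Borel sets. Completing it would
  not change which properties hold almost everywhere.
\<close>

definition circle_measure :: "complex measure" where
  "circle_measure =
     distr (restrict_space lborel {0..<2 * pi}) (restrict_space borel (sphere 0 1)) cis"

lemma measurable_cis_circle:
  "cis \<in> restrict_space lborel {0..<2 * pi} \<rightarrow>\<^sub>M restrict_space borel (sphere 0 1)"
proof -
  have "cis \<in> borel_measurable borel"
    by (intro borel_measurable_continuous_onI continuous_intros)
  then have "cis \<in> borel_measurable (restrict_space lborel {0..<2 * pi})"
    by (intro measurable_restrict_space1) simp
  then show ?thesis
    by (intro measurable_restrict_space2) auto
qed

lemma emeasure_circle_measure: "emeasure circle_measure (sphere 0 1) = ennreal (2 * pi)"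
proof -
  have "emeasure circle_measure (sphere 0 1) =
      emeasure (restrict_space lborel {0..<2 * pi}) {0..<2 * pi}"
    unfolding circle_measure_def
    by (subst emeasure_distr[OF measurable_cis_circle])
      (auto simp: sets_restrict_space space_restrict_space intro!: arg_cong2[where f = emeasure])
  also have "\<dots> = ennreal (2 * pi)"
    by (subst emeasure_restrict_space) auto
  finally show ?thesis .
qed

end

theory Submission
  imports Defs
begin

text \<open>
  Up to the convergent factor \<open>\<Prod>(1 + |\<delta>\<^sub>j|\<^sup>2)\<^bsup>-1/2\<^esup>\<close>, passing from \<open>\<delta>\<^sub>0, \<dots>, \<delta>\<^sub>j\<close> to \<open>\<delta>\<^sub>0, \<dots>, \<delta>\<^bsub>j+1\<^esub>\<close>
  adds to the trigonometric polynomials \<open>a\<close> and \<open>b\<close> a multiple of the shift by \<open>n\<^bsub>j+1\<^esub>\<close> of \<open>b\<close> and \<open>a\<close>.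
  Because \<open>n\<^bsub>j+1\<^esub> \<ge> 2 n\<^sub>j\<close>, the new frequencies are disjoint from all earlier ones, so \<open>a\<close> and \<open>b\<close>
  are lacunary partial sums of two fixed Fourier series, which are square summable since the
  \<open>\<ell>\<^sup>2\<close> norms satisfy \<open>\<parallel>a\<parallel>\<^sup>2 + \<parallel>b\<parallel>\<^sup>2 = \<Prod>(1 + |\<delta>\<^sub>j|\<^sup>2)\<close>. By Kolmogorov's theorem such partial sums
  converge almost everywhere: they differ by a square summable error from averages over intervals
  of length comparable to \<open>1 / n\<^sub>j\<close>, whose maximal function is controlled by Vitali's covering lemma.
\<close>

section \<open>Averages over intervals\<close>

text \<open>The Cauchy-Schwarz bound for an average, in elementary form: integrate \<open>2 * \<tau>
  * norm (f x) - \<tau>\<^sup>2 \<le> (norm (f x))\<^sup>2\<close> and use that the integral of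
  \<open>norm (f x)\<close> exceeds \<open>\<tau> * (d - c)\<close>.\<close>

lemma power2_integral_average_le:
  fixes f :: "real \<Rightarrow> 'a::euclidean_space"
  assumes cont: "continuous_on {c..d} f" and "c < d" "\<tau> > 0"
    and avg: "\<tau> < norm (integral {c..d} f) / (d - c)"
  shows "\<tau>\<^sup>2 * (d - c) \<le> integral {c..d} (\<lambda>x. (norm (f x))\<^sup>2)"
proof -
  have int: "(\<lambda>x. norm (f x)) integrable_on {c..d}" "(\<lambda>x. (norm (f x))\<^sup>2) integrable_on {c..d}"
    by (intro integrable_continuous_interval continuous_intros cont)+
  have "\<tau> * (d - c) < norm (integral {c..d} f)"
    using avg \<open>c < d\<close> by (simp add: field_simps)
  also have "\<dots> \<le> integral {c..d} (\<lambda>x. norm (f x))"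
    by (intro integral_norm_bound_integral integrable_continuous_interval cont int) auto
  finally have "2 * \<tau> * (\<tau> * (d - c)) \<le> 2 * \<tau> * integral {c..d} (\<lambda>x. norm (f x))"
    using \<open>\<tau> > 0\<close> by (intro mult_left_mono) auto
  moreover have "integral {c..d} (\<lambda>x. 2 * \<tau> * norm (f x) - \<tau>\<^sup>2) \<le> integral {c..d} (\<lambda>x. (norm (f x))\<^sup>2)"
  proof (intro integral_le int integrable_diff integrable_on_mult_right)
    fix x
    show "2 * \<tau> * norm (f x) - \<tau>\<^sup>2 \<le> (norm (f x))\<^sup>2"
      using sum_squares_bound[of \<tau> "norm (f x)"] by simp
  qed auto
  moreover have "integral {c..d} (\<lambda>x. 2 * \<tau> * norm (f x) - \<tau>\<^sup>2)
      = 2 * \<tau> * integral {c..d} (\<lambda>x. norm (f x)) - \<tau>\<^sup>2 * (d - c)"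
    using \<open>c < d\<close> by (subst integral_diff) (auto intro!: integrable_on_mult_right int)
  ultimately show ?thesis
    by (simp add: power2_eq_square)
qed

text \<open>Vitali's lemma selects disjoint intervals whose fivefold enlargements cover the
  exceptional points. The length of a selected interval is at most \<open>1 / \<tau>\<^sup>2\<close>
  times the integral of \<open>(norm (f x))\<^sup>2\<close> over it. By disjointness these integrals
  add up to at most the one over \<open>{a - r..b + r}\<close>, which contains all the
  intervals.\<close>

lemma weak_type_interval_averages:
  fixes f :: "real \<Rightarrow> 'a::euclidean_space" and h :: "'i \<Rightarrow> real"
  assumes cont: "continuous_on UNIV f" and "\<tau> > 0"
    and h: "\<And>j. j \<in> I \<Longrightarrow> 0 < h j \<and> h j \<le> r"
  obtains U where "U \<in> fmeasurable lborel"
    "{x \<in> {a..b}. \<exists>j\<in>I. \<tau> < norm (integral {x - h j..x + h j} f) / (2 * h j)} \<subseteq> U"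
    "measure lborel U \<le> 5 / \<tau>\<^sup>2 * integral {a - r..b + r} (\<lambda>x. (norm (f x))\<^sup>2)"
proof -
  define K where "K = {(x, j). x \<in> {a..b} \<and> j \<in> I \<and> \<tau> < norm (integral {x - h j..x + h j} f) / (2 * h j)}"
  have E: "{x \<in> {a..b}. \<exists>j\<in>I. \<tau> < norm (integral {x - h j..x + h j} f) / (2 * h j)}
      \<subseteq> (\<Union>p\<in>K. cball (fst p) (h (snd p)))"
  proof safe
    fix x j
    assume "x \<in> {a..b}" "j \<in> I" "\<tau> < norm (integral {x - h j..x + h j} f) / (2 * h j)"
    then show "x \<in> (\<Union>p\<in>K. cball (fst p) (h (snd p)))"
      using h[of j] by (intro UN_I[of "(x, j)"]) (auto simp: K_def)
  qed
  obtain C where "countable C" "C \<subseteq> K"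
    and disj: "pairwise (\<lambda>p p'. disjnt (cball (fst p) (h (snd p))) (cball (fst p') (h (snd p')))) C"
    and cov: "{x \<in> {a..b}. \<exists>j\<in>I. \<tau> < norm (integral {x - h j..x + h j} f) / (2 * h j)}
      \<subseteq> (\<Union>p\<in>C. cball (fst p) (5 * h (snd p)))"
    using Vitali_covering_lemma_cballs[OF E, of r] h by (force simp: K_def)
  let ?g = "\<lambda>x. (norm (f x))\<^sup>2"
  have int: "?g integrable_on {c..d}" for c d
    using cont by (intro integrable_continuous_interval continuous_intros continuous_on_subset[OF cont]) auto
  have cball: "cball c e = {c - e..c + e}" for c e :: real
    by (auto simp: dist_real_def)
  \<comment> \<open>Finite subfamilies let the integrals be added; the bound is uniform in
    \<open>D\<close> and so passes to the countable family \<open>C\<close>.\<close>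
  have bound: "measure lborel (\<Union>p\<in>D. cball (fst p) (5 * h (snd p)))
      \<le> 5 / \<tau>\<^sup>2 * integral {a - r..b + r} ?g" if D: "D \<subseteq> C" "finite D" for D
  proof -
    have le: "measure lborel (cball (fst p) (5 * h (snd p)))
        \<le> 5 / \<tau>\<^sup>2 * integral (cball (fst p) (h (snd p))) ?g" if "p \<in> D" for p
    proof -
      have p: "p \<in> K" using that D \<open>C \<subseteq> K\<close> by auto
      then have hp: "0 < h (snd p)" using h by (auto simp: K_def)
      have "\<tau>\<^sup>2 * ((fst p + h (snd p)) - (fst p - h (snd p)))
          \<le> integral {fst p - h (snd p)..fst p + h (snd p)} ?g"
        using p hp \<open>\<tau> > 0\<close>
        by (intro power2_integral_average_le continuous_on_subset[OF cont]) (auto simp: K_def)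
      then have "2 * h (snd p) \<le> integral {fst p - h (snd p)..fst p + h (snd p)} ?g / \<tau>\<^sup>2"
        using \<open>\<tau> > 0\<close> by (simp add: field_simps)
      then show ?thesis
        using hp unfolding cball by simp
    qed
    have has_integral: "(?g has_integral (\<Sum>p\<in>D. integral (cball (fst p) (h (snd p))) ?g))
        (\<Union>p\<in>D. cball (fst p) (h (snd p)))"
    proof (intro has_integral_UN D)
      show "(?g has_integral integral (cball (fst p) (h (snd p))) ?g) (cball (fst p) (h (snd p)))" for p
        unfolding cball using int by (rule integrable_integral)
      show "pairwise (\<lambda>p p'. negligible (cball (fst p) (h (snd p)) \<inter> cball (fst p') (h (snd p')))) D"
        using pairwise_subset[OF disj D(1)] by (rule pairwise_mono) (auto simp: disjnt_def)
    qed
    have "measure lborel (\<Union>p\<in>D. cball (fst p) (5 * h (snd p)))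
        \<le> (\<Sum>p\<in>D. measure lborel (cball (fst p) (5 * h (snd p))))"
      using D by (intro measure_UNION_le) auto
    also have "\<dots> \<le> (\<Sum>p\<in>D. 5 / \<tau>\<^sup>2 * integral (cball (fst p) (h (snd p))) ?g)"
      by (intro sum_mono le)
    also have "\<dots> = 5 / \<tau>\<^sup>2 * (\<Sum>p\<in>D. integral (cball (fst p) (h (snd p))) ?g)"
      by (simp add: sum_distrib_left)
    also have "(\<Sum>p\<in>D. integral (cball (fst p) (h (snd p))) ?g)
        = integral (\<Union>p\<in>D. cball (fst p) (h (snd p))) ?g"
      using has_integral by (rule integral_unique[symmetric])
    also have "5 / \<tau>\<^sup>2 * \<dots> \<le> 5 / \<tau>\<^sup>2 * integral {a - r..b + r} ?g"
    proof (intro mult_left_mono integral_subset_le int)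
      show "(\<Union>p\<in>D. cball (fst p) (h (snd p))) \<subseteq> {a - r..b + r}"
        using D \<open>C \<subseteq> K\<close> h unfolding cball by (fastforce simp: K_def)
      show "?g integrable_on (\<Union>p\<in>D. cball (fst p) (h (snd p)))"
        using has_integral by (rule has_integral_integrable)
    qed auto
    finally show ?thesis .
  qed
  have fmeasurable: "cball c e \<in> fmeasurable lborel" for c e :: real
    by (intro fmeasurable_compact compact_cball)
  show thesis
  proof (rule that[OF _ cov])
    show "(\<Union>p\<in>C. cball (fst p) (5 * h (snd p))) \<in> fmeasurable lborel"
      using \<open>countable C\<close> fmeasurable bound by (rule fmeasurable_UN_bound)
    show "measure lborel (\<Union>p\<in>C. cball (fst p) (5 * h (snd p)))
      \<le> 5 / \<tau>\<^sup>2 * integral {a - r..b + r} ?g"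
      using \<open>countable C\<close> fmeasurable bound by (rule measure_UN_bound)
  qed
qed

section \<open>Lacunary partial sums of Fourier series\<close>

text \<open>One-sided sums suffice: on the circle \<open>poly_b\<close> is such a sum times
  \<open>cis x\<close>, and \<open>poly_a\<close> is the conjugate of one.\<close>

definition trig_sum :: "(nat \<Rightarrow> complex) \<Rightarrow> nat \<Rightarrow> real \<Rightarrow> complex" where
  "trig_sum g K x = (\<Sum>k<K. g k * cis (real k * x))"

lemma continuous_on_trig_sum [continuous_intros]: "continuous_on S (trig_sum g K)"
  unfolding trig_sum_def by (intro continuous_intros)

lemma has_integral_cis:
  assumes "d \<noteq> 0" "a \<le> b"
  shows "((\<lambda>x. cis (d * x)) has_integral (cis (d * b) - cis (d * a)) / (\<i> * of_real d)) {a..b}"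
proof -
  have "((\<lambda>x. cis (d * x)) has_integral
      cis (d * b) / (\<i> * of_real d) - cis (d * a) / (\<i> * of_real d)) {a..b}"
  proof (intro fundamental_theorem_of_calculus \<open>a \<le> b\<close>)
    fix x
    \<comment> \<open>The primitive is differentiated as a holomorphic function and then restricted
      to the real line.\<close>
    have "((\<lambda>z. exp (\<i> * of_real d * z) / (\<i> * of_real d)) has_field_derivative cis (d * x)) (at (of_real x))"
      using \<open>d \<noteq> 0\<close> by (auto intro!: derivative_eq_intros simp: cis_conv_exp mult_ac)
    then show "((\<lambda>x. cis (d * x) / (\<i> * of_real d)) has_vector_derivative cis (d * x)) (at x within {a..b})"
      by (drule_tac has_vector_derivative_real_field) (simp add: cis_conv_exp mult_ac)
  qed
  then show ?thesis
    by (simp add: diff_divide_distrib)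
qed

lemma has_integral_cis_periods:
  assumes "b = a + 2 * pi * real m"
  shows "((\<lambda>x. cis (of_int d * x)) has_integral (if d = 0 then of_real (b - a) else 0)) {a..b}"
proof (cases "d = 0")
  case True
  have "a \<le> b" using assms by simp
  then show ?thesis using True has_integral_const_real[of "1::complex" a b]
    by (simp add: scaleR_conv_of_real)
next
  case False
  have "cis (of_int d * b) = cis (of_int d * a) * cis (2 * pi * of_int (d * int m))"
    by (simp add: assms cis_mult algebra_simps)
  also have "cis (2 * pi * of_int (d * int m)) = 1"
    by (rule cis_multiple_2pi) auto
  finally show ?thesis
    using False has_integral_cis[of "of_int d" a b] assms by simp
qed

text \<open>Parseval's identity: in the expanded square only the diagonal survives integration over
  \<open>m\<close> full periods. The case \<open>m = 3\<close> serves the interval averages,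
  \<open>m = 1\<close> the square function.\<close>

lemma has_integral_cmod_trig_sum:
  assumes "b = a + 2 * pi * real m"
  shows "((\<lambda>x. (cmod (trig_sum g K x))\<^sup>2) has_integral (b - a) * (\<Sum>k<K. (cmod (g k))\<^sup>2)) {a..b}"
proof -
  have cnj_mult: "w * cnj w = (of_real (cmod w))\<^sup>2" for w
    by (metis complex_norm_square of_real_power)
  have "((\<lambda>x. \<Sum>k<K. \<Sum>l<K. (g k * cnj (g l)) * cis (of_int (int k - int l) * x)) has_integral
      (\<Sum>k<K. \<Sum>l<K. (g k * cnj (g l)) * (if int k - int l = 0 then of_real (b - a) else 0))) {a..b}"
    by (intro has_integral_sum has_integral_mult_right has_integral_cis_periods[OF assms]) auto
  also have "(\<lambda>x. \<Sum>k<K. \<Sum>l<K. (g k * cnj (g l)) * cis (of_int (int k - int l) * x))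
      = (\<lambda>x. trig_sum g K x * cnj (trig_sum g K x))"
  proof
    fix x
    have "cis (of_int (int k - int l) * x) = cis (real k * x) * cnj (cis (real l * x))" for k l
      by (simp add: cis_cnj cis_mult algebra_simps)
    then show "(\<Sum>k<K. \<Sum>l<K. (g k * cnj (g l)) * cis (of_int (int k - int l) * x))
        = trig_sum g K x * cnj (trig_sum g K x)"
      by (simp add: trig_sum_def sum_product mult_ac)
  qed
  also have "(\<Sum>k<K. \<Sum>l<K. (g k * cnj (g l)) * (if int k - int l = 0 then of_real (b - a) else 0))
      = of_real ((b - a) * (\<Sum>k<K. (cmod (g k))\<^sup>2))"
    by (simp add: if_distrib sum_distrib_left mult.assoc[symmetric] cnj_mult cong: if_cong)
      (simp add: mult.commute)
  finally show ?thesis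
    by (drule_tac has_integral_Re) (simp add: complex_norm_square[symmetric])
qed

text \<open>At \<open>t = 0\<close> the quotient \<open>sin t / t\<close> is \<open>0\<close> and has to be replaced by \<open>1\<close>.\<close>

definition sinc :: "real \<Rightarrow> real" where
  "sinc t = (if t = 0 then 1 else sin t / t)"

text \<open>By the mean value theorem \<open>sinc t = cos s\<close> for some \<open>s\<close>
  between 0 and \<open>t\<close>, and \<open>1 - cos s\<close> is twice the square of
  \<open>sin (s / 2)\<close>. A linear bound is enough, because its squares are summed along a
  lacunary sequence.\<close>

lemma abs_one_minus_sinc_le:
  assumes "t \<ge> 0"
  shows "\<bar>1 - sinc t\<bar> \<le> t"
proof (cases "t = 0")
  case False
  then have "t > 0" using assms by simp
  then obtain s where s: "0 < s" "s < t" "sin t - sin 0 = (t - 0) * cos s"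
    using MVT2[of 0 t sin cos] DERIV_sin by blast
  have "sinc t = cos s"
    using s False by (simp add: sinc_def)
  moreover have "1 - cos s \<le> s"
  proof -
    have "1 - cos s = 2 * (sin (s / 2))\<^sup>2"
      using cos_double_sin[of "s / 2"] by simp
    also have "\<dots> \<le> 2 * \<bar>sin (s / 2)\<bar>"
      using mult_left_mono[of "\<bar>sin (s / 2)\<bar>" 1 "\<bar>sin (s / 2)\<bar>"] by (simp add: power2_eq_square)
    also have "\<dots> \<le> s"
      using abs_sin_x_le_abs_x[of "s / 2"] s by simp
    finally show ?thesis .
  qed
  ultimately show ?thesis
    using s by simp
qed (simp add: sinc_def)

lemma abs_sinc_le: "t > 0 \<Longrightarrow> \<bar>sinc t\<bar> \<le> 1 / t"
  by (simp add: sinc_def divide_right_mono)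

text \<open>Averaging over an interval is a Fourier multiplier, since
  \<open>cis (k * h) - cis (- (k * h))\<close> is \<open>2 * \<i> * sin (k * h)\<close>. This makes
  averages comparable with sharp cutoffs, frequency by frequency.\<close>

lemma integral_trig_sum_centred:
  assumes "h > 0"
  shows "integral {x - h..x + h} (trig_sum g K)
    = of_real (2 * h) * trig_sum (\<lambda>k. of_real (sinc (real k * h)) * g k) K x"
proof -
  have "((\<lambda>y. cis (real k * y)) has_integral of_real (2 * h * sinc (real k * h)) * cis (real k * x))
      {x - h..x + h}" for k
  proof (cases "k = 0")
    case True
    then show ?thesis
      using has_integral_const_real[of "1::complex" "x - h" "x + h"] assms
      by (simp add: sinc_def scaleR_conv_of_real)
  next
    case False
    have "cis (real k * (x + h)) - cis (real k * (x - h))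
        = cis (real k * x) * (cis (real k * h) - cis (- (real k * h)))"
      by (simp add: cis_mult algebra_simps)
    also have "cis (real k * h) - cis (- (real k * h)) = 2 * \<i> * of_real (sin (real k * h))"
      by (simp add: complex_eq_iff)
    finally show ?thesis
      using False has_integral_cis[of "real k" "x - h" "x + h"] assms
      by (simp add: sinc_def field_simps)
  qed
  then have "(trig_sum g K has_integral
      (\<Sum>k<K. g k * (of_real (2 * h * sinc (real k * h)) * cis (real k * x)))) {x - h..x + h}"
    unfolding trig_sum_def by (intro has_integral_sum has_integral_mult_right) auto
  then show ?thesis
    by (subst integral_unique) (auto simp: trig_sum_def sum_distrib_left mult_ac)
qed

section \<open>Geometric sums along lacunary sequences and the multiplier bound\<close>

lemma lacunary_sum_below_le:
  fixes y :: "nat \<Rightarrow> real"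
  assumes q: "q > 1" and pos: "\<And>j. y j > 0" and lac: "\<And>j. y (Suc j) \<ge> q * y j" and "t > 0"
  shows "(1 - 1 / q\<^sup>2) * (\<Sum>j<L. if y j \<le> t then (y j)\<^sup>2 else 0) \<le> t\<^sup>2"
proof -
  \<comment> \<open>Strengthened for the induction: \<open>y L / q\<close> bounds all earlier terms,
    and adding \<open>(1 - 1 / q\<^sup>2) * (y L)\<^sup>2\<close> to
    \<open>(y L / q)\<^sup>2\<close> gives exactly \<open>(y L)\<^sup>2\<close>.\<close>
  have "(1 - 1 / q\<^sup>2) * (\<Sum>j<L. if y j \<le> t then (y j)\<^sup>2 else 0) \<le> (min t (y L / q))\<^sup>2"
  proof (induction L)
    case (Suc L)
    have y: "y L \<le> y (Suc L) / q"
      using q lac[of L] by (simp add: field_simps)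
    show ?case
    proof (cases "y L \<le> t")
      case True
      have "(min t (y L / q))\<^sup>2 \<le> (y L)\<^sup>2 / q\<^sup>2"
        using q pos[of L] \<open>t > 0\<close> by (auto simp: power_divide[symmetric] intro!: power_mono)
      then have "(1 - 1 / q\<^sup>2) * (\<Sum>j<Suc L. if y j \<le> t then (y j)\<^sup>2 else 0) \<le> (y L)\<^sup>2"
        using Suc.IH True by (simp add: algebra_simps)
      also have "\<dots> \<le> (min t (y (Suc L) / q))\<^sup>2"
        using True y pos[of L] by (intro power_mono) auto
      finally show ?thesis .
    next
      case False
      have "y L / q \<le> y L"
        using q pos[of L] by (simp add: field_simps)
      then have "(min t (y L / q))\<^sup>2 \<le> (min t (y (Suc L) / q))\<^sup>2"
        using q pos[of L] y \<open>t > 0\<close> by (intro power_mono) auto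
      then show ?thesis
        using Suc.IH False by simp
    qed
  qed simp
  also have "\<dots> \<le> t\<^sup>2"
    using q pos[of L] \<open>t > 0\<close> by (intro power_mono) auto
  finally show ?thesis .
qed

lemma lacunary_sum_above_le:
  fixes y :: "nat \<Rightarrow> real"
  assumes q: "q > 1" and pos: "\<And>j. y j > 0" and lac: "\<And>j. y (Suc j) \<ge> q * y j" and "t > 0"
  shows "(1 - 1 / q\<^sup>2) * (\<Sum>j<L. if y j \<le> t then 0 else 1 / (y j)\<^sup>2) \<le> 1 / t\<^sup>2"
proof -
  \<comment> \<open>The subtracted term makes the sum telescope: once \<open>y L > t\<close>, the
    new summand turns \<open>1 / (y L)\<^sup>2\<close> into \<open>1 / (q * y L)\<^sup>2\<close>,
    which is at least \<open>1 / (y (Suc L))\<^sup>2\<close>.\<close>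
  have "(1 - 1 / q\<^sup>2) * (\<Sum>j<L. if y j \<le> t then 0 else 1 / (y j)\<^sup>2)
      \<le> 1 / t\<^sup>2 - 1 / (max t (y L))\<^sup>2"
  proof (induction L)
    case 0
    have "t\<^sup>2 \<le> (max t (y 0))\<^sup>2"
      using \<open>t > 0\<close> by (intro power_mono) auto
    then show ?case
      using \<open>t > 0\<close> by (simp add: frac_le)
  next
    case (Suc L)
    have y: "y L \<le> y (Suc L)"
      using q lac[of L] less_imp_le[OF pos[of L]] mult_right_mono[of 1 q "y L"] by simp
    show ?case
    proof (cases "y L \<le> t")
      case True
      have "1 / (max t (y (Suc L)))\<^sup>2 \<le> 1 / (max t (y L))\<^sup>2"
        using \<open>t > 0\<close> y by (intro frac_le power_mono) auto
      then show ?thesis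
        using Suc.IH True by simp
    next
      case False
      have "1 / (y (Suc L))\<^sup>2 \<le> 1 / (q * y L)\<^sup>2"
        using q lac[of L] pos[of L] by (intro frac_le power_mono) auto
      then show ?thesis
        using Suc.IH False y by (simp add: algebra_simps max_def power_mult_distrib)
    qed
  qed
  also have "\<dots> \<le> 1 / t\<^sup>2"
    by simp
  finally show ?thesis .
qed

text \<open>The summands compare, at frequency \<open>k\<close>, the cutoff at \<open>n j\<close>
  with the average of radius \<open>1 / n j\<close>. If \<open>n j \<le> k\<close> the cutoff
  vanishes and \<open>sinc\<close> is at most \<open>n j / k\<close> in modulus; otherwise the
  difference is at most \<open>k / n j\<close>. Both ranges give geometric sums, bounded
  independently of \<open>k\<close> and \<open>L\<close>.\<close>

lemma lacunary_multiplier_sum_le: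
  fixes n :: "nat \<Rightarrow> nat"
  assumes q: "q > 1" and pos: "\<And>j. n j \<ge> 1" and lac: "\<And>j. real (n (Suc j)) \<ge> q * real (n j)"
  shows "(\<Sum>j<L. (of_bool (k < n j) - sinc (real k * (1 / real (n j))))\<^sup>2) \<le> 2 / (1 - 1 / q\<^sup>2)"
proof -
  define \<kappa> where "\<kappa> = 1 - 1 / q\<^sup>2"
  have "\<kappa> > 0"
    using q by (simp add: \<kappa>_def)
  have n: "real (n j) > 0" for j
    using pos[of j] by simp
  show ?thesis
  proof (cases "k = 0")
    case True
    have "0 < n j" for j using pos[of j] by simp
    then show ?thesis
      using True \<open>\<kappa> > 0\<close> by (simp add: sinc_def \<kappa>_def)
  next
    case False
    define t where "t = real k"
    have "t > 0"
      using False by (simp add: t_def)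
    have "(of_bool (k < n j) - sinc (real k * (1 / real (n j))))\<^sup>2
        \<le> (if real (n j) \<le> t then (real (n j))\<^sup>2 else 0) / t\<^sup>2
          + t\<^sup>2 * (if real (n j) \<le> t then 0 else 1 / (real (n j))\<^sup>2)" for j
    proof (cases "n j \<le> k")
      case True
      have "\<bar>sinc (t / real (n j))\<bar>\<^sup>2 \<le> (1 / (t / real (n j)))\<^sup>2"
        using n[of j] \<open>t > 0\<close> by (intro power_mono abs_sinc_le) auto
      then show ?thesis
        using True by (simp add: t_def power_divide)
    next
      case False
      have "\<bar>1 - sinc (t / real (n j))\<bar>\<^sup>2 \<le> (t / real (n j))\<^sup>2"
        using n[of j] \<open>t > 0\<close> by (intro power_mono abs_one_minus_sinc_le) auto
      then show ?thesis
        using False by (simp add: t_def power_divide)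
    qed
    then have "(\<Sum>j<L. (of_bool (k < n j) - sinc (real k * (1 / real (n j))))\<^sup>2)
        \<le> (\<Sum>j<L. (if real (n j) \<le> t then (real (n j))\<^sup>2 else 0) / t\<^sup>2
          + t\<^sup>2 * (if real (n j) \<le> t then 0 else 1 / (real (n j))\<^sup>2))"
      by (intro sum_mono)
    also have "\<dots> = (\<Sum>j<L. if real (n j) \<le> t then (real (n j))\<^sup>2 else 0) / t\<^sup>2
          + t\<^sup>2 * (\<Sum>j<L. if real (n j) \<le> t then 0 else 1 / (real (n j))\<^sup>2)"
      by (simp only: sum.distrib sum_divide_distrib sum_distrib_left)
    also have "\<dots> \<le> 1 / \<kappa> + 1 / \<kappa>"
    proof (intro add_mono)
      show "(\<Sum>j<L. if real (n j) \<le> t then (real (n j))\<^sup>2 else 0) / t\<^sup>2 \<le> 1 / \<kappa>"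
        using lacunary_sum_below_le[of q "\<lambda>j. real (n j)" t L, OF q n lac \<open>t > 0\<close>] \<open>\<kappa> > 0\<close> \<open>t > 0\<close>
        by (simp add: \<kappa>_def[symmetric] field_simps)
      show "t\<^sup>2 * (\<Sum>j<L. if real (n j) \<le> t then 0 else 1 / (real (n j))\<^sup>2) \<le> 1 / \<kappa>"
        using lacunary_sum_above_le[of q "\<lambda>j. real (n j)" t L, OF q n lac \<open>t > 0\<close>] \<open>\<kappa> > 0\<close> \<open>t > 0\<close>
        by (simp add: \<kappa>_def[symmetric] field_simps)
    qed
    finally show ?thesis
      by (simp add: \<kappa>_def)
  qed
qed

section \<open>The maximal inequality and almost everywhere convergence\<close>

lemma markov_inequality_interval:
  fixes F :: "real \<Rightarrow> real"
  assumes cont: "continuous_on {a..b} F" and nonneg: "\<And>x. x \<in> {a..b} \<Longrightarrow> 0 \<le> F x" and "c > 0"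
  shows "{x \<in> {a..b}. c \<le> F x} \<in> fmeasurable lborel"
    and "measure lborel {x \<in> {a..b}. c \<le> F x} \<le> integral {a..b} F / c"
proof -
  let ?S = "{x \<in> {a..b}. c \<le> F x}"
  have "closed ({a..b} \<inter> F -` {c..})"
    using cont by (intro continuous_closed_preimage) auto
  then have closed: "closed ?S"
    by (simp add: vimage_def Int_def)
  moreover have "bounded ?S"
    by (rule bounded_subset[of "{a..b}"]) auto
  ultimately have "compact ?S"
    by (simp add: compact_eq_bounded_closed)
  then show "?S \<in> fmeasurable lborel"
    by (rule fmeasurable_compact)
  have int: "F integrable_on ?S"
  proof (intro set_borel_integral_eq_integral(1))
    have "continuous_on ?S F"
      by (rule continuous_on_subset[OF cont]) auto
    then show "set_integrable lborel ?S F"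
      unfolding set_integrable_def by (intro borel_integrable_compact \<open>compact ?S\<close>)
  qed
  have S: "?S \<in> lmeasurable"
    using \<open>compact ?S\<close> by (rule lmeasurable_compact)
  have "c * measure lborel ?S = c * integral ?S (\<lambda>x. 1)"
    using lmeasure_integral[OF S] closed by simp
  also have "\<dots> = integral ?S (\<lambda>x. c)"
    by (simp flip: integral_mult_right)
  also have "\<dots> \<le> integral ?S F"
    using S by (intro integral_le int integrable_on_const) auto
  also have "\<dots> \<le> integral {a..b} F"
    using cont nonneg by (intro integral_subset_le int integrable_continuous_interval) auto
  finally show "measure lborel ?S \<le> integral {a..b} F / c"
    using \<open>c > 0\<close> by (simp add: field_simps)
qed

text \<open>A partial sum is an interval average plus an error \<open>D j\<close>. Where it exceeds
  \<open>2 * \<tau>\<close>, either the average exceeds \<open>\<tau>\<close>, which Vitali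
  controls, or the error is at least \<open>\<tau>\<close>, which Parseval and Markov control. The
  bound is independent of \<open>L\<close>, so it survives a passage to infinitely many
  \<open>j\<close>.\<close>

lemma lacunary_maximal_inequality:
  fixes n :: "nat \<Rightarrow> nat"
  assumes q: "q > 1" and pos: "\<And>j. n j \<ge> 1" and lac: "\<And>j. real (n (Suc j)) \<ge> q * real (n j)"
    and "\<tau> > 0" and g: "\<And>k. k \<ge> K \<Longrightarrow> g k = 0"
  obtains U where "U \<in> fmeasurable lborel"
    "{x \<in> {0..2 * pi}. \<exists>j<L. 2 * \<tau> < cmod (trig_sum g (n j) x)} \<subseteq> U"
    "measure lborel U \<le> (30 * pi + 4 * pi / (1 - 1 / q\<^sup>2)) / \<tau>\<^sup>2 * (\<Sum>k<K. (cmod (g k))\<^sup>2)"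
proof -
  define h where "h j = 1 / real (n j)" for j
  \<comment> \<open>The generous bound \<open>2 * pi\<close> enlarges \<open>{0..2 * pi}\<close> to
    exactly three periods, where Parseval applies.\<close>
  have h: "0 < h j" "h j \<le> 2 * pi" for j
  proof -
    have "h j \<le> 1"
      using pos[of j] by (simp add: h_def)
    then show "h j \<le> 2 * pi"
      using pi_gt3 by linarith
  qed (use pos[of j] in \<open>simp add: h_def\<close>)
  define G where "G = (\<Sum>k<K. (cmod (g k))\<^sup>2)"
  define w where "w j k = of_bool (k < n j) - sinc (real k * h j)" for j k
  define D where "D j = trig_sum (\<lambda>k. of_real (w j k) * g k) K" for j
  have D: "D j x = trig_sum g (n j) x - integral {x - h j..x + h j} (trig_sum g K) / of_real (2 * h j)" for j x
  proof -
    \<comment> \<open>As \<open>g\<close> vanishes from \<open>K\<close> on, the cutoff at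
      \<open>n j\<close> becomes a multiplier in a sum over \<open>k < K\<close>, whichever of the
      two is larger.\<close>
    have "trig_sum g (n j) x = (\<Sum>k<K. of_bool (k < n j) * g k * cis (real k * x))"
      unfolding trig_sum_def using g
      by (intro sum.mono_neutral_cong) (auto simp: not_less)
    also have "\<dots> - (\<Sum>k<K. of_real (sinc (real k * h j)) * g k * cis (real k * x)) = D j x"
      unfolding D_def trig_sum_def w_def sum_subtractf[symmetric]
      by (intro sum.cong) (auto simp: algebra_simps)
    also have "(\<Sum>k<K. of_real (sinc (real k * h j)) * g k * cis (real k * x))
        = integral {x - h j..x + h j} (trig_sum g K) / of_real (2 * h j)"
      using h(1)[of j] by (simp add: integral_trig_sum_centred trig_sum_def)
    finally show ?thesis by simp
  qed
  obtain U where U: "U \<in> fmeasurable lborel"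
    "{x \<in> {0..2 * pi}. \<exists>j\<in>UNIV. \<tau> < norm (integral {x - h j..x + h j} (trig_sum g K)) / (2 * h j)} \<subseteq> U"
    "measure lborel U \<le> 5 / \<tau>\<^sup>2 * integral {0 - 2 * pi..2 * pi + 2 * pi} (\<lambda>x. (norm (trig_sum g K x))\<^sup>2)"
    by (rule weak_type_interval_averages[of "trig_sum g K" \<tau> UNIV h "2 * pi" 0 "2 * pi"])
      (use h \<open>\<tau> > 0\<close> continuous_on_trig_sum in auto)
  have "integral {0 - 2 * pi..2 * pi + 2 * pi} (\<lambda>x. (norm (trig_sum g K x))\<^sup>2) = 6 * pi * G"
    by (subst integral_unique[OF has_integral_cmod_trig_sum[where m = 3]]) (auto simp: G_def)
  with U have mU: "measure lborel U \<le> 30 * pi / \<tau>\<^sup>2 * G"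
    by (simp add: mult_ac)
  \<comment> \<open>The square function of the errors: it dominates every single error, and its
    integral is computed by Parseval.\<close>
  define F where "F x = (\<Sum>j<L. (cmod (D j x))\<^sup>2)" for x
  have F_cont: "continuous_on {0..2 * pi} F"
    unfolding F_def D_def by (intro continuous_intros)
  have F_nonneg: "0 \<le> F x" for x
    by (simp add: F_def sum_nonneg)
  define V where "V = {x \<in> {0..2 * pi}. \<tau>\<^sup>2 \<le> F x}"
  have "\<tau>\<^sup>2 > 0" using \<open>\<tau> > 0\<close> by simp
  note V = markov_inequality_interval[OF F_cont F_nonneg this, folded V_def]
  have "integral {0..2 * pi} F = (\<Sum>j<L. 2 * pi * (\<Sum>k<K. (cmod (of_real (w j k) * g k))\<^sup>2))"
    unfolding F_def D_def
    using has_integral_cmod_trig_sum[where m = 1 and a = 0 and b = "2 * pi"]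
    by (intro integral_unique has_integral_sum) auto
  \<comment> \<open>With the sum over \<open>j\<close> innermost, the multiplier bound applies to
    each frequency separately.\<close>
  also have "\<dots> = 2 * pi * (\<Sum>k<K. (\<Sum>j<L. (w j k)\<^sup>2) * (cmod (g k))\<^sup>2)"
    by (simp add: norm_mult power_mult_distrib sum_distrib_left sum_distrib_right sum.swap[of _ "{..<L}"] mult_ac)
  also have "\<dots> \<le> 2 * pi * (\<Sum>k<K. 2 / (1 - 1 / q\<^sup>2) * (cmod (g k))\<^sup>2)"
    unfolding w_def h_def
    by (intro mult_left_mono sum_mono mult_right_mono lacunary_multiplier_sum_le[where n = n, OF q pos lac]) auto
  also have "\<dots> = 4 * pi / (1 - 1 / q\<^sup>2) * G"
    by (simp add: G_def sum_distrib_left mult.assoc)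
  finally have "measure lborel V \<le> 4 * pi / (1 - 1 / q\<^sup>2) * G / \<tau>\<^sup>2"
    using V(2) \<open>\<tau>\<^sup>2 > 0\<close> by (meson divide_right_mono less_imp_le order_trans)
  moreover have "measure lborel (U \<union> V) \<le> measure lborel U + measure lborel V"
    using U V by (intro measure_Un_le) auto
  ultimately have "measure lborel (U \<union> V) \<le> (30 * pi + 4 * pi / (1 - 1 / q\<^sup>2)) / \<tau>\<^sup>2 * G"
    using mU by (simp add: add_divide_distrib distrib_right)
  moreover have "{x \<in> {0..2 * pi}. \<exists>j<L. 2 * \<tau> < cmod (trig_sum g (n j) x)} \<subseteq> U \<union> V"
  proof safe
    fix x j
    assume x: "x \<in> {0..2 * pi}" and j: "j < L" and large: "2 * \<tau> < cmod (trig_sum g (n j) x)" and "x \<notin> V"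
    then have "F x < \<tau>\<^sup>2"
      by (auto simp: V_def)
    moreover have "(cmod (D j x))\<^sup>2 \<le> F x"
      unfolding F_def using j by (intro member_le_sum) auto
    ultimately have "(cmod (D j x))\<^sup>2 < \<tau>\<^sup>2"
      by simp
    then have "cmod (D j x) < \<tau>"
      using \<open>\<tau> > 0\<close> by (simp add: power_less_imp_less_base)
    moreover have "cmod (trig_sum g (n j) x)
        \<le> cmod (D j x) + cmod (integral {x - h j..x + h j} (trig_sum g K) / of_real (2 * h j))"
      unfolding D by (metis diff_add_cancel norm_triangle_ineq)
    moreover have "cmod (integral {x - h j..x + h j} (trig_sum g K) / of_real (2 * h j))
        = norm (integral {x - h j..x + h j} (trig_sum g K)) / (2 * h j)"
      using h(1)[of j] by (simp add: norm_divide)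
    ultimately have "\<tau> < norm (integral {x - h j..x + h j} (trig_sum g K)) / (2 * h j)"
      using large by linarith
    then show "x \<in> U"
      using U(2) x by blast
  qed
  moreover have "U \<union> V \<in> fmeasurable lborel"
    using U V by blast
  ultimately show thesis
    using that unfolding G_def by blast
qed

lemma trig_sum_measurable [measurable]: "trig_sum g K \<in> borel_measurable borel"
  by (intro borel_measurable_continuous_onI continuous_on_trig_sum)

text \<open>The maximal inequality is applied to the block of coefficients between
  \<open>n m\<close> and \<open>n L\<close>. The resulting bound involves only the tail from
  \<open>n m\<close> on, so \<open>L\<close> can tend to infinity along the increasing sets
  \<open>E' L\<close>.\<close>

lemma lacunary_oscillation_measure_le:
  fixes n :: "nat \<Rightarrow> nat" and m :: nat
  assumes q: "q > 1" and pos: "\<And>j. n j \<ge> 1" and lac: "\<And>j. real (n (Suc j)) \<ge> q * real (n j)"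
    and "\<tau> > 0" and g: "summable (\<lambda>k. (cmod (g k))\<^sup>2)"
  defines "E \<equiv> {x \<in> {0..2 * pi}. \<exists>j\<ge>m. 2 * \<tau> < cmod (trig_sum g (n j) x - trig_sum g (n m) x)}"
  shows "E \<in> fmeasurable lborel"
    and "measure lborel E
      \<le> (30 * pi + 4 * pi / (1 - 1 / q\<^sup>2)) / \<tau>\<^sup>2 * (\<Sum>k. (cmod (g (k + n m)))\<^sup>2)"
proof -
  define B where "B = (30 * pi + 4 * pi / (1 - 1 / q\<^sup>2)) / \<tau>\<^sup>2 * (\<Sum>k. (cmod (g (k + n m)))\<^sup>2)"
  define E' where "E' L = {x \<in> {0..2 * pi}. \<exists>j<L. m \<le> j \<and> 2 * \<tau> < cmod (trig_sum g (n j) x - trig_sum g (n m) x)}"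
    for L
  have mono: "n i \<le> n j" if "i \<le> j" for i j
  proof (rule lift_Suc_mono_le[OF _ that])
    show "n j \<le> n (Suc j)" for j
      using q lac[of j] mult_right_mono[of 1 q "real (n j)"] by simp
  qed
  have E'_sets: "E' L \<in> sets lborel" for L
    unfolding E'_def by measurable
  have E': "E' L \<in> fmeasurable lborel \<and> measure lborel (E' L) \<le> B" for L
  proof -
    \<comment> \<open>Removing the frequencies below \<open>n m\<close> turns differences of partial
      sums of \<open>g\<close> into partial sums of \<open>c\<close>.\<close>
    define c where "c k = (if n m \<le> k \<and> k < n L then g k else 0)" for k
    have c: "trig_sum c (n j) x = trig_sum g (n j) x - trig_sum g (n m) x" if "m \<le> j" "j < L" for j x
    proof -
      have "trig_sum g (n j) x = trig_sum g (n m) x + (\<Sum>k=n m..<n j. g k * cis (real k * x))"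
        unfolding trig_sum_def lessThan_atLeast0 using mono[OF that(1)]
        by (subst sum.atLeastLessThan_concat) auto
      moreover have "trig_sum c (n j) x = (\<Sum>k=n m..<n j. g k * cis (real k * x))"
        unfolding trig_sum_def c_def using mono[of j L] that
        by (intro sum.mono_neutral_cong_right) auto
      ultimately show ?thesis by simp
    qed
    obtain U where U: "U \<in> fmeasurable lborel"
      "{x \<in> {0..2 * pi}. \<exists>j<L. 2 * \<tau> < cmod (trig_sum c (n j) x)} \<subseteq> U"
      "measure lborel U \<le> (30 * pi + 4 * pi / (1 - 1 / q\<^sup>2)) / \<tau>\<^sup>2 * (\<Sum>k<n L. (cmod (c k))\<^sup>2)"
      using lacunary_maximal_inequality[where n = n and L = L and K = "n L" and g = c, OF q pos lac \<open>\<tau> > 0\<close>]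
      by (auto simp: c_def)
    have sub: "E' L \<subseteq> U"
      using U(2) c by (fastforce simp: E'_def)
    have "(\<Sum>k<n L. (cmod (c k))\<^sup>2) = (\<Sum>k\<in>{n m..<n L}. (cmod (g k))\<^sup>2)"
      unfolding c_def by (intro sum.mono_neutral_cong_right) auto
    also have "\<dots> = (\<Sum>k<n L - n m. (cmod (g (k + n m)))\<^sup>2)"
      by (intro sum.reindex_bij_witness[of _ "\<lambda>k. k + n m" "\<lambda>k. k - n m"]) auto
    also have "\<dots> \<le> (\<Sum>k. (cmod (g (k + n m)))\<^sup>2)"
      using g by (intro sum_le_suminf summable_ignore_initial_segment) auto
    finally have le: "(\<Sum>k<n L. (cmod (c k))\<^sup>2) \<le> (\<Sum>k. (cmod (g (k + n m)))\<^sup>2)" .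
    have "0 \<le> 1 - 1 / q\<^sup>2"
      using q by simp
    then have "0 \<le> (30 * pi + 4 * pi / (1 - 1 / q\<^sup>2)) / \<tau>\<^sup>2"
      by (intro divide_nonneg_nonneg add_nonneg_nonneg) auto
    with U(3) le have "measure lborel U \<le> B"
      unfolding B_def by (meson mult_left_mono order_trans)
    moreover have "measure lborel (E' L) \<le> measure lborel U"
      using sub E'_sets U(1) by (intro measure_mono_fmeasurable) auto
    ultimately show ?thesis
      using fmeasurableI2[OF U(1) sub E'_sets] by simp
  qed
  have Un: "(\<Union>L\<le>N. E' L) = E' N" for N
    by (auto simp: E'_def intro: less_le_trans)
  have E: "E = (\<Union>L. E' L)"
    by (auto simp: E_def E'_def)
  show "E \<in> fmeasurable lborel"
    unfolding E using E' by (intro fmeasurable_countable_Union) (auto simp: Un)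
  show "measure lborel E \<le> (30 * pi + 4 * pi / (1 - 1 / q\<^sup>2)) / \<tau>\<^sup>2 * (\<Sum>k. (cmod (g (k + n m)))\<^sup>2)"
    unfolding E B_def[symmetric] using E' by (intro measure_countable_Union_le) (auto simp: Un)
qed

text \<open>Points whose oscillation beyond every \<open>m\<close> exceeds a fixed threshold lie in
  all \<open>E \<tau> m\<close>, whose measures tend to 0 with the tails of the coefficient series.
  Countably many thresholds then yield the Cauchy property outside a null set.\<close>

theorem kolmogorov_lacunary_partial_sums:
  fixes n :: "nat \<Rightarrow> nat"
  assumes q: "q > 1" and pos: "\<And>j. n j \<ge> 1" and lac: "\<And>j. real (n (Suc j)) \<ge> q * real (n j)"
    and g: "summable (\<lambda>k. (cmod (g k))\<^sup>2)"
  shows "AE x in lborel. x \<in> {0..2 * pi} \<longrightarrow> convergent (\<lambda>j. trig_sum g (n j) x)"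
proof -
  define E where "E \<tau> m = {x \<in> {0..2 * pi}. \<exists>j\<ge>m. 2 * \<tau> < cmod (trig_sum g (n j) x - trig_sum g (n m) x)}"
    for \<tau> m
  have n_ge: "j \<le> n j" for j
  proof (induction j)
    case (Suc j)
    have "real (n j) < q * real (n j)"
      using q pos[of j] by simp
    then have "real (n j) < real (n (Suc j))"
      using lac[of j] by linarith
    with Suc show ?case by simp
  qed simp
  have "filterlim n at_top sequentially"
    by (rule filterlim_at_top_mono[OF filterlim_ident]) (auto simp: n_ge)
  have null: "(\<Inter>m. E \<tau> m) \<in> null_sets lborel" if "\<tau> > 0" for \<tau>
  proof -
    define C where "C = (30 * pi + 4 * pi / (1 - 1 / q\<^sup>2)) / \<tau>\<^sup>2"
    note E = lacunary_oscillation_measure_le[where n = n, OF q pos lac that g, folded E_def C_def]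
    have meas: "(\<Inter>m. E \<tau> m) \<in> sets lborel"
      using fmeasurableD[OF E(1)] by (intro sets.countable_INT) auto
    have fin: "(\<Inter>m. E \<tau> m) \<in> fmeasurable lborel"
      by (rule fmeasurableI2[OF E(1)[of 0] _ meas]) auto
    have "(\<lambda>N. \<Sum>k. (cmod (g (k + N)))\<^sup>2) \<longlonglongrightarrow> 0"
      using suminf_exist_split2[OF g] .
    then have "(\<lambda>m. C * (\<Sum>k. (cmod (g (k + n m)))\<^sup>2)) \<longlonglongrightarrow> C * 0"
      by (intro tendsto_mult_left filterlim_compose[OF _ \<open>filterlim n at_top sequentially\<close>])
    moreover have "measure lborel (\<Inter>m. E \<tau> m) \<le> C * (\<Sum>k. (cmod (g (k + n m)))\<^sup>2)" for m
    proof -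
      have "measure lborel (\<Inter>m. E \<tau> m) \<le> measure lborel (E \<tau> m)"
        by (rule measure_mono_fmeasurable[OF _ meas E(1)[of m]]) auto
      with E(2)[of m] show ?thesis by linarith
    qed
    ultimately have "measure lborel (\<Inter>m. E \<tau> m) \<le> C * 0"
      by (intro LIMSEQ_le_const) auto
    then have "measure lborel (\<Inter>m. E \<tau> m) = 0"
      by (simp add: measure_le_0_iff)
    then show ?thesis
      using emeasure_eq_measure2[OF fin] meas by (intro null_setsI) simp_all
  qed
  have "AE x in lborel. \<forall>i::nat. x \<notin> (\<Inter>m. E (1 / Suc i) m)"
    unfolding AE_all_countable using null by (intro allI AE_not_in) simp
  then show ?thesis
  proof (rule AE_mp, intro AE_I2 impI)
    fix x
    assume x: "\<forall>i::nat. x \<notin> (\<Inter>m. E (1 / Suc i) m)" "x \<in> {0..2 * pi}"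
    have "Cauchy (\<lambda>j. trig_sum g (n j) x)"
      unfolding Cauchy_altdef2
    proof (intro allI impI)
      fix e :: real
      assume "e > 0"
      then obtain i :: nat where i: "1 / Suc i < e / 2"
        using nat_approx_posE[of "e / 2"] by auto
      obtain m where "x \<notin> E (1 / Suc i) m"
        using x by blast
      then have "\<forall>j\<ge>m. cmod (trig_sum g (n j) x - trig_sum g (n m) x) \<le> 2 * (1 / Suc i)"
        using x by (auto simp: E_def not_less)
      then show "\<exists>m. \<forall>j\<ge>m. dist (trig_sum g (n j) x) (trig_sum g (n m) x) < e"
        using i by (intro exI[of _ m]) (auto simp: dist_norm intro: le_less_trans)
    qed
    then show "convergent (\<lambda>j. trig_sum g (n j) x)"
      by (rule Cauchy_convergent)
  qed
qed

section \<open>The transform of a lacunary sequence\<close>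

text \<open>The substitution \<open>k \<mapsto> N - 1 - k\<close> reverses the second block. Since
  \<open>2 * m \<le> N\<close>, that block has length at least \<open>m\<close> and thus contains
  the whole reflected support of \<open>b\<close>.\<close>

lemma sum_reflected_block:
  fixes a b :: "nat \<Rightarrow> 'a::comm_monoid_add"
  assumes "2 * m \<le> N" and b: "\<And>l. m \<le> l \<Longrightarrow> b l = 0"
  shows "(\<Sum>k<N. if k < m then a k else b (N - 1 - k)) = (\<Sum>k<m. a k) + (\<Sum>l<m. b l)"
proof -
  have "(\<Sum>k<N. if k < m then a k else b (N - 1 - k))
      = (\<Sum>k<m. a k) + (\<Sum>k=m..<N. b (N - 1 - k))"
    using assms(1) unfolding lessThan_atLeast0
    by (subst sum.atLeastLessThan_concat[of 0 m N, symmetric]) auto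
  also have "(\<Sum>k=m..<N. b (N - 1 - k)) = (\<Sum>l<N - m. b l)"
    by (intro sum.reindex_bij_witness[of _ "\<lambda>l. N - 1 - l" "\<lambda>k. N - 1 - k"]) auto
  also have "\<dots> = (\<Sum>l<m. b l)"
    using assms by (intro sum.mono_neutral_right) auto
  finally show ?thesis .
qed

text \<open>
  Without the factors \<open>(1 + |d\<^sub>i|\<^sup>2)\<^bsup>-1/2\<^esup>\<close>, the transform of \<open>d\<^sub>0, \<dots>, d\<^sub>j\<close> is
  \<open>\<Sum>k<n j. u k * z\<^bsup>-k\<^esup>\<close> and \<open>\<Sum>k<n j. v k * z\<^bsup>k+1\<^esup>\<close>, where \<open>(u, v)\<close> is the pair of coefficient
  sequences \<open>lacunary_coeffs n d j\<close>.
\<close>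

primrec lacunary_coeffs ::
    "(nat \<Rightarrow> nat) \<Rightarrow> (nat \<Rightarrow> complex) \<Rightarrow> nat \<Rightarrow> (nat \<Rightarrow> complex) \<times> (nat \<Rightarrow> complex)" where
  "lacunary_coeffs n d 0 = (\<lambda>k. of_bool (k = 0), \<lambda>k. of_bool (k = 0) * d 0)"
| "lacunary_coeffs n d (Suc j) =
    (let (u, v) = lacunary_coeffs n d j; N = n (Suc j) in
      (\<lambda>k. if k < n j then u k else if k < N then - cnj (d (Suc j)) * v (N - 1 - k) else 0,
       \<lambda>k. if k < n j then v k else if k < N then d (Suc j) * u (N - 1 - k) else 0))"

definition coeff_a :: "(nat \<Rightarrow> nat) \<Rightarrow> (nat \<Rightarrow> complex) \<Rightarrow> nat \<Rightarrow> nat \<Rightarrow> complex" where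
  "coeff_a n d j = fst (lacunary_coeffs n d j)"

definition coeff_b :: "(nat \<Rightarrow> nat) \<Rightarrow> (nat \<Rightarrow> complex) \<Rightarrow> nat \<Rightarrow> nat \<Rightarrow> complex" where
  "coeff_b n d j = snd (lacunary_coeffs n d j)"

lemma coeff_0:
  "coeff_a n d 0 = (\<lambda>k. of_bool (k = 0))" "coeff_b n d 0 = (\<lambda>k. of_bool (k = 0) * d 0)"
  by (simp_all add: coeff_a_def coeff_b_def)

lemma coeff_Suc:
  "coeff_a n d (Suc j) k = (if k < n j then coeff_a n d j k
    else if k < n (Suc j) then - cnj (d (Suc j)) * coeff_b n d j (n (Suc j) - 1 - k) else 0)"
  "coeff_b n d (Suc j) k = (if k < n j then coeff_b n d j k
    else if k < n (Suc j) then d (Suc j) * coeff_a n d j (n (Suc j) - 1 - k) else 0)"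
  by (simp_all add: coeff_a_def coeff_b_def Let_def split: prod.split)

definition nlft_norm_const :: "(nat \<Rightarrow> complex) \<Rightarrow> nat \<Rightarrow> real" where
  "nlft_norm_const d j = (\<Prod>i\<le>j. 1 / sqrt (1 + (cmod (d i))\<^sup>2))"

definition poly_a :: "(nat \<Rightarrow> nat) \<Rightarrow> (nat \<Rightarrow> complex) \<Rightarrow> nat \<Rightarrow> complex \<Rightarrow> complex" where
  "poly_a n d j z = (\<Sum>k<n j. coeff_a n d j k * inverse z ^ k)"

text \<open>The frequencies of \<open>b\<close> start at 1, so index \<open>k\<close> stands for
  \<open>z ^ (k + 1)\<close>. With this shift both coefficient sequences occupy the indices below
  \<open>n j\<close>, and the same reflection \<open>k \<mapsto> n (Suc j) - 1 - k\<close> exchanges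
  them.\<close>

definition poly_b :: "(nat \<Rightarrow> nat) \<Rightarrow> (nat \<Rightarrow> complex) \<Rightarrow> nat \<Rightarrow> complex \<Rightarrow> complex" where
  "poly_b n d j z = z * (\<Sum>k<n j. coeff_b n d j k * z ^ k)"

context
  fixes n :: "nat \<Rightarrow> nat" and d :: "nat \<Rightarrow> complex"
  assumes n0: "n 0 = 1" and n_Suc: "\<And>j. 2 * n j \<le> n (Suc j)"
begin

lemma index_pos: "n j \<ge> 1"
proof (induction j)
  case (Suc j)
  then show ?case using n_Suc[of j] by linarith
qed (simp add: n0)

lemma index_strict_mono: "strict_mono n"
proof (rule strict_monoI_Suc)
  show "n j < n (Suc j)" for j
    using n_Suc[of j] index_pos[of j] by linarith
qed

lemma less_index: "j < n j"
proof (induction j)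
  case (Suc j)
  then show ?case using n_Suc[of j] by linarith
qed (simp add: n0)

lemma coeff_eq_0:
  assumes "n j \<le> k"
  shows "coeff_a n d j k = 0" "coeff_b n d j k = 0"
proof -
  have "coeff_a n d j k = 0 \<and> coeff_b n d j k = 0"
  proof (cases j)
    case 0
    then show ?thesis using assms n0 by (simp add: coeff_0)
  next
    case (Suc i)
    then show ?thesis using assms n_Suc[of i] by (simp add: coeff_Suc)
  qed
  then show "coeff_a n d j k = 0" "coeff_b n d j k = 0" by auto
qed

lemma coeff_stable:
  assumes "i \<le> j" "k < n i"
  shows "coeff_a n d j k = coeff_a n d i k" "coeff_b n d j k = coeff_b n d i k"
  using assms(1)
proof (induction j rule: dec_induct)
  case (step j)
  have "n i \<le> n j"
    using step(1) index_strict_mono by (simp add: strict_mono_less_eq)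
  with assms(2) step show "coeff_a n d (Suc j) k = coeff_a n d i k" "coeff_b n d (Suc j) k = coeff_b n d i k"
    by (simp_all add: coeff_Suc)
qed auto

text \<open>The diagonal \<open>coeff_a n d k k\<close> is the coefficient sequence of the limiting
  series: since \<open>k < n k\<close>, the entry at \<open>k\<close> is final from stage
  \<open>k\<close> on. The polynomials of all stages are thereby partial sums of two fixed
  series.\<close>

lemma coeff_limit:
  assumes "k < n j"
  shows "coeff_a n d j k = coeff_a n d k k" "coeff_b n d j k = coeff_b n d k k"
proof -
  have "coeff_a n d j k = coeff_a n d k k \<and> coeff_b n d j k = coeff_b n d k k"
  proof (cases "j \<le> k")
    case True
    show ?thesis
      unfolding coeff_stable[OF True assms] by simp
  next
    case False
    then show ?thesis
      using coeff_stable[of k j k, OF _ less_index] by auto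
  qed
  then show "coeff_a n d j k = coeff_a n d k k" "coeff_b n d j k = coeff_b n d k k"
    by auto
qed

lemma poly_Suc:
  assumes "z \<noteq> 0"
  shows "poly_a n d (Suc j) z = poly_a n d j z - cnj (d (Suc j)) * inverse z ^ n (Suc j) * poly_b n d j z"
    and "poly_b n d (Suc j) z = poly_b n d j z + d (Suc j) * z ^ n (Suc j) * poly_a n d j z"
proof -
  let ?N = "n (Suc j)" and ?w = "inverse z"
  \<comment> \<open>Here \<open>y\<close> is the inverse of \<open>x\<close>; the bound
    \<open>l < n j\<close> keeps the natural subtraction from being cut off at 0.\<close>
  have pow: "x ^ (?N - 1 - l) = x ^ ?N * y ^ Suc l" if "x * y = 1" "l < n j" for x y :: complex and l
  proof -
    have "?N = (?N - 1 - l) + Suc l"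
      using n_Suc[of j] that(2) by linarith
    then have "x ^ ?N * y ^ Suc l = x ^ (?N - 1 - l) * (x * y) ^ Suc l"
      by (metis (no_types, lifting) mult.assoc power_add power_mult_distrib)
    then show ?thesis
      using that(1) by simp
  qed
  \<comment> \<open>The exponent \<open>k\<close> is written as \<open>?N - 1 - (?N - 1 - k)\<close>
    so that the second block is a function of the reflected index.\<close>
  have "poly_a n d (Suc j) z = (\<Sum>k<?N. if k < n j then coeff_a n d j k * ?w ^ k
      else - cnj (d (Suc j)) * coeff_b n d j (?N - 1 - k) * ?w ^ (?N - 1 - (?N - 1 - k)))"
    unfolding poly_a_def by (intro sum.cong) (auto simp: coeff_Suc)
  also have "\<dots> = poly_a n d j z
      + (\<Sum>l<n j. - cnj (d (Suc j)) * coeff_b n d j l * ?w ^ (?N - 1 - l))"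
    unfolding poly_a_def by (rule sum_reflected_block[OF n_Suc]) (simp add: coeff_eq_0)
  also have "(\<Sum>l<n j. - cnj (d (Suc j)) * coeff_b n d j l * ?w ^ (?N - 1 - l))
      = - cnj (d (Suc j)) * ?w ^ ?N * poly_b n d j z"
    unfolding poly_b_def sum_distrib_left
  proof (intro sum.cong refl)
    fix l assume "l \<in> {..<n j}"
    then have pow_l: "?w ^ (?N - 1 - l) = ?w ^ ?N * z ^ Suc l"
      using assms by (intro pow) auto
    show "- cnj (d (Suc j)) * coeff_b n d j l * ?w ^ (?N - 1 - l)
        = - cnj (d (Suc j)) * ?w ^ ?N * (z * (coeff_b n d j l * z ^ l))"
      unfolding pow_l by simp
  qed
  finally show "poly_a n d (Suc j) z = poly_a n d j z - cnj (d (Suc j)) * ?w ^ ?N * poly_b n d j z"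
    by simp
  have "(\<Sum>k<?N. coeff_b n d (Suc j) k * z ^ k) = (\<Sum>k<?N. if k < n j then coeff_b n d j k * z ^ k
      else d (Suc j) * coeff_a n d j (?N - 1 - k) * z ^ (?N - 1 - (?N - 1 - k)))"
    by (intro sum.cong) (auto simp: coeff_Suc)
  also have "\<dots> = (\<Sum>k<n j. coeff_b n d j k * z ^ k)
      + (\<Sum>l<n j. d (Suc j) * coeff_a n d j l * z ^ (?N - 1 - l))"
    by (rule sum_reflected_block[OF n_Suc]) (simp add: coeff_eq_0)
  also have "(\<Sum>l<n j. d (Suc j) * coeff_a n d j l * z ^ (?N - 1 - l))
      = ?w * (d (Suc j) * z ^ ?N * poly_a n d j z)"
    unfolding poly_a_def sum_distrib_left
  proof (intro sum.cong refl)
    fix l assume "l \<in> {..<n j}"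
    then have pow_l: "z ^ (?N - 1 - l) = z ^ ?N * ?w ^ Suc l"
      using assms by (intro pow) auto
    show "d (Suc j) * coeff_a n d j l * z ^ (?N - 1 - l)
        = ?w * (d (Suc j) * z ^ ?N * (coeff_a n d j l * ?w ^ l))"
      unfolding pow_l by simp
  qed
  finally show "poly_b n d (Suc j) z = poly_b n d j z + d (Suc j) * z ^ ?N * poly_a n d j z"
    using assms by (simp add: poly_b_def distrib_left mult.assoc[symmetric])
qed

text \<open>Each stage keeps the old coefficients and adds, at new positions, reflected copies
  scaled by the modulus of \<open>d (Suc j)\<close>. Hence the sum of squares is multiplied by
  \<open>1 + (cmod (d (Suc j)))\<^sup>2\<close>.\<close>

lemma sum_coeff_squares:
  "(\<Sum>k<n j. (cmod (coeff_a n d j k))\<^sup>2 + (cmod (coeff_b n d j k))\<^sup>2) = (\<Prod>i\<le>j. 1 + (cmod (d i))\<^sup>2)"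
proof (induction j)
  case 0
  then show ?case by (simp add: n0 coeff_0)
next
  case (Suc j)
  let ?N = "n (Suc j)"
  let ?s = "\<lambda>k. (cmod (coeff_a n d j k))\<^sup>2 + (cmod (coeff_b n d j k))\<^sup>2"
  have "(\<Sum>k<?N. (cmod (coeff_a n d (Suc j) k))\<^sup>2 + (cmod (coeff_b n d (Suc j) k))\<^sup>2)
      = (\<Sum>k<?N. if k < n j then ?s k else (cmod (d (Suc j)))\<^sup>2 * ?s (?N - 1 - k))"
    by (intro sum.cong) (auto simp: coeff_Suc norm_mult power_mult_distrib algebra_simps)
  also have "\<dots> = (\<Sum>k<n j. ?s k) + (\<Sum>l<n j. (cmod (d (Suc j)))\<^sup>2 * ?s l)"
    by (rule sum_reflected_block[OF n_Suc]) (simp add: coeff_eq_0)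
  also have "\<dots> = (1 + (cmod (d (Suc j)))\<^sup>2) * (\<Sum>k<n j. ?s k)"
    by (simp only: distrib_right sum_distrib_left[symmetric] mult_1)
  also have "\<dots> = (\<Prod>i\<le>Suc j. 1 + (cmod (d i))\<^sup>2)"
    unfolding Suc.IH by (simp only: prod.atMost_Suc mult.commute)
  finally show ?case .
qed

text \<open>The inequality \<open>1 + x \<le> exp x\<close> bounds the products of
  \<open>sum_coeff_squares\<close> uniformly in the stage.\<close>

lemma summable_coeff_squares:
  assumes "summable (\<lambda>i. (cmod (d i))\<^sup>2)"
  shows "summable (\<lambda>k. (cmod (coeff_a n d k k))\<^sup>2)" "summable (\<lambda>k. (cmod (coeff_b n d k k))\<^sup>2)"
proof -
  let ?s = "\<lambda>k. (cmod (coeff_a n d k k))\<^sup>2 + (cmod (coeff_b n d k k))\<^sup>2"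
  have "(\<Sum>k<j. ?s k) \<le> exp (\<Sum>i. (cmod (d i))\<^sup>2)" for j
  proof -
    have "(\<Sum>k<j. ?s k) \<le> (\<Sum>k<n j. ?s k)"
      using less_index[of j] by (intro sum_mono2) auto
    also have "\<dots> = (\<Sum>k<n j. (cmod (coeff_a n d j k))\<^sup>2 + (cmod (coeff_b n d j k))\<^sup>2)"
      by (intro sum.cong) (simp_all add: coeff_limit[of _ j])
    also have "\<dots> = (\<Prod>i\<le>j. 1 + (cmod (d i))\<^sup>2)"
      by (rule sum_coeff_squares)
    also have "\<dots> \<le> (\<Prod>i\<le>j. exp ((cmod (d i))\<^sup>2))"
      by (intro prod_mono) (auto simp: add_nonneg_nonneg)
    also have "\<dots> = exp (\<Sum>i\<le>j. (cmod (d i))\<^sup>2)"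
      by (simp add: exp_sum)
    also have "\<dots> \<le> exp (\<Sum>i. (cmod (d i))\<^sup>2)"
      using assms by (simp add: sum_le_suminf)
    finally show ?thesis .
  qed
  then have s: "summable ?s"
    by (intro summableI_nonneg_bounded[where x = "exp (\<Sum>i. (cmod (d i))\<^sup>2)"] add_nonneg_nonneg)
      simp_all
  show "summable (\<lambda>k. (cmod (coeff_a n d k k))\<^sup>2)" "summable (\<lambda>k. (cmod (coeff_b n d k k))\<^sup>2)"
    by (rule summable_comparison_test'[OF s, where N = 0], simp)+
qed

lemma AE_convergent_poly:
  assumes "summable (\<lambda>i. (cmod (d i))\<^sup>2)"
  shows "AE x in lborel. x \<in> {0..2 * pi} \<longrightarrow>
    convergent (\<lambda>j. poly_a n d j (cis x)) \<and> convergent (\<lambda>j. poly_b n d j (cis x))"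
proof -
  have lac: "real (n (Suc j)) \<ge> 2 * real (n j)" for j
    using n_Suc[of j] by linarith
  \<comment> \<open>On the circle \<open>inverse z\<close> is the conjugate of \<open>z\<close>, so
    negative frequencies become nonnegative after conjugation.\<close>
  have a: "poly_a n d j (cis x) = cnj (trig_sum (\<lambda>k. cnj (coeff_a n d k k)) (n j) x)" for j x
    unfolding poly_a_def trig_sum_def cnj_sum
    by (intro sum.cong) (auto simp: coeff_limit(1)[of _ j] cis_cnj Complex.DeMoivre)
  have b: "poly_b n d j (cis x) = cis x * trig_sum (\<lambda>k. coeff_b n d k k) (n j) x" for j x
    unfolding poly_b_def trig_sum_def
    by (intro arg_cong2[where f = times] sum.cong) (auto simp: coeff_limit(2)[of _ j] Complex.DeMoivre)
  have convergent_cnj: "convergent (\<lambda>j. cnj (f j))" if "convergent f" for f :: "nat \<Rightarrow> complex"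
    using that tendsto_cnj unfolding convergent_def by blast
  have "AE x in lborel. x \<in> {0..2 * pi} \<longrightarrow> convergent (\<lambda>j. trig_sum (\<lambda>k. cnj (coeff_a n d k k)) (n j) x)"
    using summable_coeff_squares[OF assms] index_pos lac
    by (intro kolmogorov_lacunary_partial_sums[where q = 2]) auto
  moreover have "AE x in lborel. x \<in> {0..2 * pi} \<longrightarrow> convergent (\<lambda>j. trig_sum (\<lambda>k. coeff_b n d k k) (n j) x)"
    using summable_coeff_squares[OF assms] index_pos lac
    by (intro kolmogorov_lacunary_partial_sums[where q = 2]) auto
  ultimately show ?thesis
  proof eventually_elim
    case (elim x)
    show ?case
    proof (intro impI conjI)
      assume "x \<in> {0..2 * pi}"
      with elim have conv: "convergent (\<lambda>j. trig_sum (\<lambda>k. cnj (coeff_a n d k k)) (n j) x)"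
        "convergent (\<lambda>j. trig_sum (\<lambda>k. coeff_b n d k k) (n j) x)"
        by auto
      show "convergent (\<lambda>j. poly_a n d j (cis x))"
        unfolding a using conv(1) by (rule convergent_cnj)
      show "convergent (\<lambda>j. poly_b n d j (cis x))"
        unfolding b using convergent_const conv(2) by (rule convergent_mult)
    qed
  qed
qed

end

section \<open>The transform matrices of a lacunary sequence\<close>

lemma nlft_norm_const_Suc:
  "nlft_norm_const d (Suc j) = 1 / sqrt (1 + (cmod (d (Suc j)))\<^sup>2) * nlft_norm_const d j"
  unfolding nlft_norm_const_def by (simp only: prod.atMost_Suc mult.commute)

text \<open>Every factor lies between 0 and 1, so the partial products decrease and stay
  nonnegative.\<close>

lemma convergent_nlft_norm_const: "convergent (nlft_norm_const d)"
proof (rule Bseq_monoseq_convergent)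
  have nonneg: "0 \<le> nlft_norm_const d j" for j
    unfolding nlft_norm_const_def by (intro prod_nonneg) auto
  have dec: "nlft_norm_const d (Suc j) \<le> nlft_norm_const d j" for j
  proof -
    have "1 / sqrt (1 + (cmod (d (Suc j)))\<^sup>2) \<le> 1"
      using real_sqrt_ge_one[of "1 + (cmod (d (Suc j)))\<^sup>2"] by (simp add: divide_le_eq_1 add_pos_nonneg)
    from mult_left_mono[OF this nonneg[of j]] show ?thesis
      by (simp add: nlft_norm_const_def)
  qed
  then show "monoseq (nlft_norm_const d)"
    by (simp add: monoseq_Suc)
  show "Bseq (nlft_norm_const d)"
    using decseq_SucI[where X = "nlft_norm_const d", OF dec] nonneg by (rule decseq_bounded[OF _ allI])
qed

text \<open>A zero entry contributes the identity factor, and below \<open>- int N\<close> the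
  matrices are the identity anyway. This covers both the gaps between the \<open>n j\<close> and the
  nonpositive indices.\<close>

lemma nlft_matrix_gap:
  assumes "l \<le> p" and "\<And>m. \<lbrakk>l < m; m \<le> p\<rbrakk> \<Longrightarrow> G m = 0"
  shows "nlft_matrix G N p z = nlft_matrix G N l z"
  using assms
proof (induction p rule: int_ge_induct)
  case (step p)
  have "nlft_factor 0 (p + 1) z = mat 1"
    by (simp add: vec_eq_iff forall_2 nlft_factor_def mat_def)
  moreover have "trunc G N (p + 1) = 0"
    using step by (simp add: trunc_def)
  ultimately have "nlft_matrix G N (p + 1) z = nlft_matrix G N p z"
    by (cases "p + 1 < - int N")
      (simp_all add: nlft_matrix.simps[of G N "p + 1"] nlft_matrix.simps[of G N p])
  with step show ?case by simp
qed simp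

lemma nlft_factor_component:
  fixes g :: complex
  defines "c \<equiv> complex_of_real (1 / sqrt (1 + (cmod g)\<^sup>2))"
  shows "nlft_factor g k z $ 1 $ 1 = c" "nlft_factor g k z $ 1 $ 2 = c * (- cnj g * z powi (- k))"
    "nlft_factor g k z $ 2 $ 1 = c * (g * z powi k)" "nlft_factor g k z $ 2 $ 2 = c"
  unfolding nlft_factor_def vector_scaleR_component vector_2
  by (simp_all only: scaleR_conv_of_real c_def mult_1_right)

text \<open>The first column, which holds \<open>a\<close> and \<open>b\<close>, satisfies a
  recursion of its own because the new factor multiplies from the left.\<close>

lemma nlft_matrix_step:
  fixes G :: "int \<Rightarrow> complex"
  assumes "\<bar>k\<bar> \<le> int N"
  defines "c \<equiv> complex_of_real (1 / sqrt (1 + (cmod (G k))\<^sup>2))"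
  shows "nlft_matrix G N k z $ 1 $ 1 = c * (nlft_matrix G N (k - 1) z $ 1 $ 1
      - cnj (G k) * z powi (- k) * nlft_matrix G N (k - 1) z $ 2 $ 1)"
    and "nlft_matrix G N k z $ 2 $ 1 = c * (nlft_matrix G N (k - 1) z $ 2 $ 1
      + G k * z powi k * nlft_matrix G N (k - 1) z $ 1 $ 1)"
proof -
  have "nlft_matrix G N k z = nlft_factor (G k) k z ** nlft_matrix G N (k - 1) z"
    using assms(1) by (subst nlft_matrix.simps) (auto simp: trunc_def)
  then show "nlft_matrix G N k z $ 1 $ 1 = c * (nlft_matrix G N (k - 1) z $ 1 $ 1
      - cnj (G k) * z powi (- k) * nlft_matrix G N (k - 1) z $ 2 $ 1)"
    "nlft_matrix G N k z $ 2 $ 1 = c * (nlft_matrix G N (k - 1) z $ 2 $ 1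
      + G k * z powi k * nlft_matrix G N (k - 1) z $ 1 $ 1)"
    by (simp_all add: nlft_factor_component matrix_matrix_mult_def sum_2 c_def algebra_simps)
qed

text \<open>The matrices change only at the indices \<open>n j\<close>, where the column recursion
  is that of \<open>poly_Suc\<close> times the new normalising factor.\<close>

lemma nlft_matrix_lacunary:
  assumes n0: "n 0 = 1" and n_Suc: "\<And>j. 2 * n j \<le> n (Suc j)"
    and G: "\<And>j. G (int (n j)) = d j" and G0: "\<And>k. k \<notin> range (\<lambda>j. int (n j)) \<Longrightarrow> G k = 0"
    and "z \<noteq> 0" and m: "n j \<le> m" "m < n (Suc j)" "m \<le> N"
  shows "nlft_matrix G N (int m) z $ 1 $ 1 = of_real (nlft_norm_const d j) * poly_a n d j z"
    and "nlft_matrix G N (int m) z $ 2 $ 1 = of_real (nlft_norm_const d j) * poly_b n d j z"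
proof -
  note mono = index_strict_mono[of n, OF n0 n_Suc]
  have gap: "nlft_matrix G N (int p) z = nlft_matrix G N (int (n j)) z" if "n j \<le> p" "p < n (Suc j)" for j p
  proof (rule nlft_matrix_gap)
    fix k assume k: "int (n j) < k" "k \<le> int p"
    have "k \<noteq> int (n i)" for i
    proof
      assume "k = int (n i)"
      then have "n j < n i" "n i < n (Suc j)"
        using k that by auto
      then show False
        using strict_mono_less[OF mono] by simp
    qed
    then show "G k = 0"
      by (intro G0) auto
  qed (use that in simp)
  have start: "nlft_matrix G N 0 z = mat 1"
  proof -
    have "nlft_matrix G N 0 z = nlft_matrix G N (- int N - 1) z"
    proof (rule nlft_matrix_gap)
      fix k :: int assume "k \<le> 0"
      then have "k \<noteq> int (n i)" for i
        using index_pos[of n i, OF n0 n_Suc] by linarith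
      then show "G k = 0"
        by (intro G0) auto
    qed simp
    then show ?thesis
      by (simp add: nlft_matrix.simps)
  qed
  have "nlft_matrix G N (int (n j)) z $ 1 $ 1 = of_real (nlft_norm_const d j) * poly_a n d j z \<and>
    nlft_matrix G N (int (n j)) z $ 2 $ 1 = of_real (nlft_norm_const d j) * poly_b n d j z"
    if "n j \<le> N" for j
    using that
  proof (induction j)
    case 0
    then show ?case
      using nlft_matrix_step[of "int (n 0)" N G z] G[of 0] start n0
      by (simp add: mat_def nlft_norm_const_def poly_a_def poly_b_def coeff_0)
  next
    case (Suc j)
    let ?k = "int (n (Suc j))"
    have less: "n j < n (Suc j)"
      using strict_mono_less[OF mono] by simp
    have "nlft_matrix G N (int (n (Suc j) - 1)) z = nlft_matrix G N (int (n j)) z"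
      using less by (intro gap) auto
    then have prev: "nlft_matrix G N (?k - 1) z = nlft_matrix G N (int (n j)) z"
      using less by (simp add: of_nat_diff)
    have pow: "z powi (- ?k) = inverse z ^ n (Suc j)" "z powi ?k = z ^ n (Suc j)"
      by (simp_all add: power_int_minus power_inverse)
    have IH: "nlft_matrix G N (int (n j)) z $ 1 $ 1 = of_real (nlft_norm_const d j) * poly_a n d j z"
      "nlft_matrix G N (int (n j)) z $ 2 $ 1 = of_real (nlft_norm_const d j) * poly_b n d j z"
      using Suc.IH Suc.prems less by auto
    have k: "\<bar>?k\<bar> \<le> int N"
      using Suc.prems by simp
    show ?case
      unfolding nlft_matrix_step[OF k] prev pow G IH poly_Suc[where n = n and d = d and z = z and j = j, OF n0 n_Suc \<open>z \<noteq> 0\<close>]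
      unfolding nlft_norm_const_Suc of_real_mult by (simp only: right_diff_distrib distrib_left mult_ac)
  qed
  then show "nlft_matrix G N (int m) z $ 1 $ 1 = of_real (nlft_norm_const d j) * poly_a n d j z"
    "nlft_matrix G N (int m) z $ 2 $ 1 = of_real (nlft_norm_const d j) * poly_b n d j z"
    using gap[OF m(1,2)] m by auto
qed

lemma convergent_piecewise_constant:
  fixes n :: "nat \<Rightarrow> nat" and X Y :: "nat \<Rightarrow> 'a::topological_space"
  assumes "strict_mono n" "convergent Y"
    and X: "\<And>j N. \<lbrakk>n j \<le> N; N < n (Suc j)\<rbrakk> \<Longrightarrow> X N = Y j"
  shows "convergent X"
proof -
  obtain L where L: "Y \<longlonglongrightarrow> L"
    using \<open>convergent Y\<close> by (auto simp: convergent_def)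
  have "X \<longlonglongrightarrow> L"
  proof (rule topological_tendstoI)
    fix S assume "open S" "L \<in> S"
    then obtain i where i: "\<And>j. j \<ge> i \<Longrightarrow> Y j \<in> S"
      using topological_tendstoD[OF L] by (auto simp: eventually_sequentially)
    \<comment> \<open>Induction on \<open>N\<close> finds the block containing it: the block index
      increases exactly when \<open>Suc N\<close> reaches \<open>n (Suc j)\<close>.\<close>
    have "\<exists>j\<ge>i. n j \<le> N \<and> N < n (Suc j)" if "n i \<le> N" for N
      using that
    proof (induction N rule: dec_induct)
      case base
      show ?case
        using strict_monoD[OF \<open>strict_mono n\<close>, of i "Suc i"] by (intro exI[of _ i]) simp
    next
      case (step N)
      then obtain j where j: "j \<ge> i" "n j \<le> N" "N < n (Suc j)"
        by blast
      show ?case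
      proof (cases "Suc N < n (Suc j)")
        case True
        with j show ?thesis by (intro exI[of _ j]) simp
      next
        case False
        with j have "Suc N = n (Suc j)"
          by simp
        with j strict_monoD[OF \<open>strict_mono n\<close>, of "Suc j" "Suc (Suc j)"] show ?thesis
          by (intro exI[of _ "Suc j"]) simp
      qed
    qed
    then have "X N \<in> S" if "n i \<le> N" for N
      using X i that by metis
    then show "eventually (\<lambda>N. X N \<in> S) sequentially"
      by (auto simp: eventually_sequentially)
  qed
  then show ?thesis
    by (auto simp: convergent_def)
qed

section \<open>Measurability and transfer to the circle\<close>

text \<open>Continuity is used for Borel measurability on the circle; the origin is excluded because
  of the negative powers of \<open>z\<close>.\<close>

lemma continuous_on_nlft_matrix:
  assumes "0 \<notin> S"
  shows "continuous_on S (\<lambda>z. nlft_matrix G N k z $ i $ j)"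
proof (induction "nat (k + int N + 1)" arbitrary: k i j)
  case 0
  then have "k < - int N"
    by linarith
  then show ?case
    by (simp add: nlft_matrix.simps)
next
  case (Suc l)
  then have "l = nat ((k - 1) + int N + 1)" and k: "\<not> k < - int N"
    by linarith+
  then have prev: "continuous_on S (\<lambda>z. nlft_matrix G N (k - 1) z $ i $ j)" for i j
    using Suc.hyps(1) by blast
  have factor: "continuous_on S (\<lambda>z. nlft_factor (trunc G N k) k z $ i $ j)" for i j
    using exhaust_2[of i] exhaust_2[of j]
    by (elim disjE; simp only: nlft_factor_component; intro continuous_intros; use assms in auto)
  have "nlft_matrix G N k z = nlft_factor (trunc G N k) k z ** nlft_matrix G N (k - 1) z" for z
    using k by (subst nlft_matrix.simps) simp
  then have "nlft_matrix G N k z $ i $ j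
      = nlft_factor (trunc G N k) k z $ i $ 1 * nlft_matrix G N (k - 1) z $ 1 $ j
        + nlft_factor (trunc G N k) k z $ i $ 2 * nlft_matrix G N (k - 1) z $ 2 $ j" for z
    by (simp add: matrix_matrix_mult_def sum_2)
  then show ?case
    by (simp only:) (intro continuous_on_add continuous_on_mult prev factor)
qed

lemma nlft_measurable_circle:
  "nlft_a G N \<in> borel_measurable (restrict_space borel (sphere 0 1))"
  "nlft_b G N \<in> borel_measurable (restrict_space borel (sphere 0 1))"
  unfolding nlft_a_def[abs_def] nlft_b_def[abs_def] nlft_a_partial_def nlft_b_partial_def
  by (intro borel_measurable_continuous_on_restrict continuous_on_nlft_matrix; simp)+

lemma AE_circle_measure_iff:
  assumes "{z \<in> sphere 0 1. P z} \<in> sets (restrict_space borel (sphere 0 1))"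
  shows "(AE z in circle_measure. P z) \<longleftrightarrow> (AE x in lborel. x \<in> {0..<2 * pi} \<longrightarrow> P (cis x))"
  using assms unfolding circle_measure_def
  by (subst AE_distr_iff[OF measurable_cis_circle])
    (auto simp: space_restrict_space AE_restrict_space_iff)

lemma convergent_nlft:
  assumes "convergent (\<lambda>N. nlft_a G N z)" "convergent (\<lambda>N. nlft_b G N z)"
  shows "convergent (\<lambda>N. nlft G N z)"
proof -
  obtain a b where ab: "(\<lambda>N. nlft_a G N z) \<longlonglongrightarrow> a" "(\<lambda>N. nlft_b G N z) \<longlonglongrightarrow> b"
    using assms by (auto simp: convergent_def)
  have "(\<lambda>N. nlft G N z) \<longlonglongrightarrow> vector [a, b]"
  proof (rule vec_tendstoI)
    fix i :: 2
    show "(\<lambda>N. nlft G N z $ i) \<longlonglongrightarrow> vector [a, b] $ i"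
      using exhaust_2[of i] ab by (auto simp: nlft_def)
  qed
  then show ?thesis
    by (auto simp: convergent_def)
qed

theorem corollary1p6:
  fixes q :: real and n :: "nat \<Rightarrow> nat" and \<delta> :: "nat \<Rightarrow> complex" and G :: "int \<Rightarrow> complex"
  assumes "q \<ge> 2"
    and "\<And>j. n j \<ge> 1"
    and "n 0 = 1"
    and "\<And>j. real (n (Suc j)) / real (n j) \<ge> q"
    and "summable (\<lambda>j. (cmod (\<delta> j))\<^sup>2)"
    and "\<And>j. G (int (n j)) = \<delta> j"
    and "\<And>m. m \<notin> range (\<lambda>j. int (n j)) \<Longrightarrow> G m = 0"
  shows "AE z in circle_measure. convergent (\<lambda>N. nlft G N z)"
proof -
  \<comment> \<open>The ratio condition enters as this doubling of the indices, which separates the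
    frequency blocks.\<close>
  have n_Suc: "2 * n j \<le> n (Suc j)" for j
  proof -
    have "2 \<le> real (n (Suc j)) / real (n j)"
      using assms(1) assms(4)[of j] by linarith
    then have "2 * real (n j) \<le> real (n (Suc j))"
      using assms(2)[of j] by (simp add: le_divide_eq)
    then show ?thesis by linarith
  qed
  have limit: "convergent (\<lambda>N. nlft_a G N z) \<and> convergent (\<lambda>N. nlft_b G N z)"
    if "z \<noteq> 0" and conv: "convergent (\<lambda>j. poly_a n \<delta> j z)" "convergent (\<lambda>j. poly_b n \<delta> j z)" for z
  proof -
    have "convergent (\<lambda>j. complex_of_real (nlft_norm_const \<delta> j))"
      using convergent_nlft_norm_const by (rule convergent_of_real)
    with conv have "convergent (\<lambda>j. of_real (nlft_norm_const \<delta> j) * poly_a n \<delta> j z)"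
      "convergent (\<lambda>j. of_real (nlft_norm_const \<delta> j) * poly_b n \<delta> j z)"
      by (auto intro: convergent_mult)
    note this[THEN convergent_piecewise_constant[OF index_strict_mono[OF assms(3) n_Suc]]]
    then show ?thesis
      using nlft_matrix_lacunary[where n = n and d = \<delta> and G = G, OF assms(3) n_Suc assms(6,7) \<open>z \<noteq> 0\<close>]
      by (simp add: nlft_a_def nlft_b_def nlft_a_partial_def nlft_b_partial_def)
  qed
  \<comment> \<open>The transfer of null sets through \<open>cis\<close> requires a measurable
    convergence set; completeness lets it be described by the Cauchy condition.\<close>
  have "{z \<in> space (restrict_space borel (sphere 0 1)). Cauchy (\<lambda>N. nlft_a G N z) \<and> Cauchy (\<lambda>N. nlft_b G N z)}
      \<in> sets (restrict_space borel (sphere 0 1))"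
    using nlft_measurable_circle by (intro sets.sets_Collect_conj sets_Collect_Cauchy) 
  then have meas: "{z \<in> sphere 0 1. convergent (\<lambda>N. nlft_a G N z) \<and> convergent (\<lambda>N. nlft_b G N z)}
      \<in> sets (restrict_space borel (sphere 0 1))"
    by (simp add: Cauchy_convergent_iff space_restrict_space)
  have "AE x in lborel. x \<in> {0..<2 * pi} \<longrightarrow>
      convergent (\<lambda>N. nlft_a G N (cis x)) \<and> convergent (\<lambda>N. nlft_b G N (cis x))"
    using AE_convergent_poly[OF assms(3) n_Suc assms(5)] by eventually_elim (simp add: limit)
  then have "AE z in circle_measure. convergent (\<lambda>N. nlft_a G N z) \<and> convergent (\<lambda>N. nlft_b G N z)"
    using AE_circle_measure_iff[OF meas] by simp
  then show ?thesis
    by eventually_elim (auto intro: convergent_nlft)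
qed

end
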